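(* Let $M$ be a submonoid of a monoid $A$. Then $M$ is the zero-class of some congruence on $A$ if and only if the following condition holds: (C) for every $x,y\in A$ and every $u\in M$, $\;xy\in M\Leftrightarrow xuy\in M$. In this case, $M$ is exactly the zero-class of $\sim_M$.
   Context: Monoids are written multiplicatively with unit $1$. A congruence on $A$ is an equivalence relation on $A$ that is a submonoid of $A\times A$. The zero-class of a relation $E$ on $A$ is $[1]_E=\{u\in A\mid (1,u)\in E\}$. The syntactic $M$-congruence $\sim_M$ on $A$ is defined by: $a\sim_M b$ if for every $x,y\in A$, $xay\in M\Leftrightarrow xby\in M$. *)

theory Defs
  imports "HOL-Algebra.Group"
begin

definition monoid_congruence :: "('a, 'b) monoid_scheme \<Rightarrow> 'a rel \<Rightarrow> bool" where
  "monoid_congruence A E \<longleftrightarrow> equiv (carrier A) E \<and> submonoid E (A \<times>\<times> A)"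

definition zero_class_of :: "('a, 'b) monoid_scheme \<Rightarrow> 'a rel \<Rightarrow> 'a set" where
  "zero_class_of A E = {u \<in> carrier A. (\<one>\<^bsub>A\<^esub>, u) \<in> E}"

definition syntactic_congruence :: "('a, 'b) monoid_scheme \<Rightarrow> 'a set \<Rightarrow> 'a rel" where
  "syntactic_congruence A M =
     {(a, b). a \<in> carrier A \<and> b \<in> carrier A \<and>
        (\<forall>x \<in> carrier A. \<forall>y \<in> carrier A.
           x \<otimes>\<^bsub>A\<^esub> a \<otimes>\<^bsub>A\<^esub> y \<in> M \<longleftrightarrow> x \<otimes>\<^bsub>A\<^esub> b \<otimes>\<^bsub>A\<^esub> y \<in> M)}"

lemma monoid_congruence_syntactic_congruence:
  assumes "monoid A"
  shows "monoid_congruence A (syntactic_congruence A M)"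
proof -
  interpret monoid A by fact
  have "equiv (carrier A) (syntactic_congruence A M)"
    by (rule equivI) (auto simp: syntactic_congruence_def refl_on_def intro!: symI transI)
  moreover have "submonoid (syntactic_congruence A M) (A \<times>\<times> A)"
  proof
    show "syntactic_congruence A M \<subseteq> carrier (A \<times>\<times> A)"
      by (auto simp: syntactic_congruence_def)
    show "\<one>\<^bsub>A \<times>\<times> A\<^esub> \<in> syntactic_congruence A M"
      by (simp add: syntactic_congruence_def)
  next
    fix p q
    assume "p \<in> syntactic_congruence A M" "q \<in> syntactic_congruence A M"
    then obtain a b c d where pq: "p = (a, b)" "q = (c, d)"
      and cl: "a \<in> carrier A" "b \<in> carrier A" "c \<in> carrier A" "d \<in> carrier A"
      and ab: "\<And>x y. x \<in> carrier A \<Longrightarrow> y \<in> carrier A \<Longrightarrow>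
                 x \<otimes>\<^bsub>A\<^esub> a \<otimes>\<^bsub>A\<^esub> y \<in> M \<longleftrightarrow> x \<otimes>\<^bsub>A\<^esub> b \<otimes>\<^bsub>A\<^esub> y \<in> M"
      and cd: "\<And>x y. x \<in> carrier A \<Longrightarrow> y \<in> carrier A \<Longrightarrow>
                 x \<otimes>\<^bsub>A\<^esub> c \<otimes>\<^bsub>A\<^esub> y \<in> M \<longleftrightarrow> x \<otimes>\<^bsub>A\<^esub> d \<otimes>\<^bsub>A\<^esub> y \<in> M"
      unfolding syntactic_congruence_def by auto
    have "x \<otimes>\<^bsub>A\<^esub> (a \<otimes>\<^bsub>A\<^esub> c) \<otimes>\<^bsub>A\<^esub> y \<in> M \<longleftrightarrow> x \<otimes>\<^bsub>A\<^esub> (b \<otimes>\<^bsub>A\<^esub> d) \<otimes>\<^bsub>A\<^esub> y \<in> M"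
      if "x \<in> carrier A" "y \<in> carrier A" for x y
      using ab[of x "c \<otimes>\<^bsub>A\<^esub> y"] cd[of "x \<otimes>\<^bsub>A\<^esub> b" y] cl that by (simp add: m_assoc)
    then show "p \<otimes>\<^bsub>A \<times>\<times> A\<^esub> q \<in> syntactic_congruence A M"
      using cl pq by (simp add: syntactic_congruence_def)
  qed
  ultimately show ?thesis
    by (simp add: monoid_congruence_def)
qed

end

theory Submission
  imports Defs
begin

text \<open>If E is a congruence and 1 E u, multiplying by x on the left and by y on the right gives
  xy E xuy, so the class of 1 contains both products or neither
  (\<open>zero_class_insert_iff\<close>). Conversely, condition (C) says that every u in M can
  replace 1 in any two-sided context, that is, u is syntactically equivalent to 1; the trivial
  context, together with 1 in M, shows that nothing outside M is
  (\<open>zero_class_syntactic_congruence\<close>). Since the syntactic relation is a congruence, it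
  is then the required witness.\<close>

lemma monoid_congruence_mult:
  assumes "monoid_congruence A E" and "(a, b) \<in> E" and "(c, d) \<in> E"
  shows "(a \<otimes>\<^bsub>A\<^esub> c, b \<otimes>\<^bsub>A\<^esub> d) \<in> E"
  using submonoid.m_closed[of E "A \<times>\<times> A" "(a, b)" "(c, d)"] assms
  by (simp add: monoid_congruence_def)

lemma zero_class_insert_iff:
  assumes "monoid A" and E: "monoid_congruence A E"
    and x: "x \<in> carrier A" and y: "y \<in> carrier A" and u: "u \<in> zero_class_of A E"
  shows "x \<otimes>\<^bsub>A\<^esub> y \<in> zero_class_of A E \<longleftrightarrow> x \<otimes>\<^bsub>A\<^esub> u \<otimes>\<^bsub>A\<^esub> y \<in> zero_class_of A E"
proof -
  interpret monoid A by fact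
  have eq: "equiv (carrier A) E"
    using E by (simp add: monoid_congruence_def)
  have uA: "u \<in> carrier A" and 1: "(\<one>\<^bsub>A\<^esub>, u) \<in> E"
    using u by (simp_all add: zero_class_of_def)
  have xx: "(x, x) \<in> E" and yy: "(y, y) \<in> E"
    using x y eq by (auto simp: equiv_def refl_on_def)
  \<comment> \<open>Reflexivity at \<open>x\<close> and \<open>y\<close> allows (1, u) to be
    multiplied on both sides; the left component x1y collapses to xy.\<close>
  have "(x \<otimes>\<^bsub>A\<^esub> y, x \<otimes>\<^bsub>A\<^esub> u \<otimes>\<^bsub>A\<^esub> y) \<in> E"
    using monoid_congruence_mult[OF E monoid_congruence_mult[OF E xx 1] yy] x by simp
  then have "(\<one>\<^bsub>A\<^esub>, x \<otimes>\<^bsub>A\<^esub> y) \<in> E \<longleftrightarrow> (\<one>\<^bsub>A\<^esub>, x \<otimes>\<^bsub>A\<^esub> u \<otimes>\<^bsub>A\<^esub> y) \<in> E"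
    using eq by (meson equivE symE transE)
  then show ?thesis
    using x y uA by (simp add: zero_class_of_def)
qed

lemma zero_class_syntactic_congruence:
  assumes "monoid A" and "submonoid M A"
    and C: "\<And>x y u. \<lbrakk>x \<in> carrier A; y \<in> carrier A; u \<in> M\<rbrakk>
              \<Longrightarrow> x \<otimes>\<^bsub>A\<^esub> y \<in> M \<longleftrightarrow> x \<otimes>\<^bsub>A\<^esub> u \<otimes>\<^bsub>A\<^esub> y \<in> M"
  shows "zero_class_of A (syntactic_congruence A M) = M"
proof -
  interpret monoid A by fact
  interpret M: submonoid M A by fact
  show ?thesis
  proof
    \<comment> \<open>For the pair (1, u) the context condition reads xy in M iff xuy in M, which is
      \<open>C\<close> itself.\<close>
    show "M \<subseteq> zero_class_of A (syntactic_congruence A M)"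
      using C by (auto simp: zero_class_of_def syntactic_congruence_def)
    show "zero_class_of A (syntactic_congruence A M) \<subseteq> M"
    proof
      fix u
      assume "u \<in> zero_class_of A (syntactic_congruence A M)"
      \<comment> \<open>The context x = y = 1 suffices: its left side is 1, which lies in the
        submonoid, and its right side is u.\<close>
      then have "u \<in> carrier A"
        and "\<one>\<^bsub>A\<^esub> \<otimes>\<^bsub>A\<^esub> \<one>\<^bsub>A\<^esub> \<otimes>\<^bsub>A\<^esub> \<one>\<^bsub>A\<^esub> \<in> M \<longleftrightarrow> \<one>\<^bsub>A\<^esub> \<otimes>\<^bsub>A\<^esub> u \<otimes>\<^bsub>A\<^esub> \<one>\<^bsub>A\<^esub> \<in> M"
        by (auto simp only: zero_class_of_def syntactic_congruence_def one_closed)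
      then show "u \<in> M"
        by simp
    qed
  qed
qed

theorem proposition1:
  fixes A :: "('a, 'b) monoid_scheme" and M :: "'a set"
  assumes "monoid A" and "submonoid M A"
  shows "((\<exists>E. monoid_congruence A E \<and> M = zero_class_of A E) \<longleftrightarrow>
          (\<forall>x \<in> carrier A. \<forall>y \<in> carrier A. \<forall>u \<in> M.
             x \<otimes>\<^bsub>A\<^esub> y \<in> M \<longleftrightarrow> x \<otimes>\<^bsub>A\<^esub> u \<otimes>\<^bsub>A\<^esub> y \<in> M))
       \<and> ((\<exists>E. monoid_congruence A E \<and> M = zero_class_of A E) \<longrightarrow>
            M = zero_class_of A (syntactic_congruence A M))"
    (is "(?Z \<longleftrightarrow> ?C) \<and> (?Z \<longrightarrow> ?S)")
proof -
  \<comment> \<open>The cycle ?Z, ?C, ?S, ?Z of implications yields both the equivalence and the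
    explicit congruence.\<close>
  have "?C" if "?Z"
    using that zero_class_insert_iff[OF assms(1)] by blast
  moreover have "?S" if "?C"
    using zero_class_syntactic_congruence[OF assms] that by blast
  moreover have "?Z" if "?S"
    using monoid_congruence_syntactic_congruence[OF assms(1)] that by blast
  ultimately show ?thesis
    by blast
qed

end
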